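(* Let $E$ be a Euclidean space, $U\subset E$, $T:U\rightrightarrows U$ with a chosen selection $x\mapsto x^+\in Tx$ (and $x^{++}:=(x^+)^+\in Tx^+$), and let $V:U\to\mathbb{R}_+$ be a smooth Lyapunov function with respect to $(\omega_1,\omega_2)$ on $U$ for the difference inclusion $x^+\in Tx$. Suppose that $\langle\nabla V(x^+),x-x^+\rangle=0$ for all $x\in U$. Then $L_T\in\mathbf{MCS}(V)$ with $\Lambda=\pi_T$ and $\psi=T^2$ (i.e. $\psi x=x^{++}$).
   Context: $C(a,b,c)$ is the circumcenter of non-colinear points $a,b,c$: the unique point of $\operatorname{aff}\{a,b,c\}$ equidistant from $a,b,c$. $H(y,z):=\frac{y+z}{2}+\{y-z\}^\perp$. $P_S$ is the orthogonal projection onto $S$. The maps $\pi_T$ and $L_T$ are $$\pi_Tx:=2(x^{++}-x^+)+2P_{\operatorname{span}(x^{++}-x^+)}(x^+-x)+x,$$ $$L_Tx:=\begin{cases}C(x,2x^+-x,\pi_Tx)&\text{if }x,2x^+-x,\pi_Tx\text{ are not colinear},\\ x^+&\text{otherwise}.\end{cases}$$ Lyapunov function: for continuous $\omega_1,\omega_2:E\to\mathbb{R}_+$, $V:U\to\mathbb{R}_+$ is a Lyapunov function with respect to $(\omega_1,\omega_2)$ on $U$ for $x^+\in Tx$ if there are continuous, zero-at-zero, monotone increasing, unbounded $\alpha_1,\alpha_2:\mathbb{R}_+\to\mathbb{R}_+$ such that for all $x\in U$: $\alpha_1(\omega_1(x))\le V(x)\le\alpha_2(\omega_2(x))$; $\sup_{x^+\in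 Tx}V(x^+)\le V(x)e^{-1}$; and $V(x)=0\iff x\in\mathcal{A}$, where $\mathcal{A}$ is the set of $\xi\in U$ such that $\omega_1(\varphi(k))=0$ for every $k\in\mathbb{N}$ and every sequence $\varphi$ with $\varphi(0)=\xi$ and $\varphi(j+1)\in T(\varphi(j))$ for all $j$. $\mathbf{MCS}(V)$: $\Omega_T\in\mathbf{MCS}(V)$ with maps $\Lambda,\psi$ if for all $x\in U$ $$\Omega_Tx=\begin{cases}C(x,2x^+-x,\Lambda x)&\text{if }x,2x^+-x,\Lambda x\text{ are not colinear},\\ x^+&\text{otherwise},\end{cases}$$ $\psi x\in H(x,\Lambda x)\cap\operatorname{aff}\{x,2x^+-x,\Lambda x\}$, $\;x^++\mathbb{R}\nabla V(x^+)\subset H(x,2x^+-x)$, and $\psi x+\mathbb{R}\nabla V(\psi x)\subset H(\Lambda x,x)$ (with $\psi x\in U$).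
   Formalization: At points where x, x⁺, x⁺⁺ are not colinear but π_T x = x, the requirement ψx ∈ aff{x, 2x⁺−x, Λx} is false and is not claimed; all other MCS(V) requirements are proved there, and all requirements at every other point of U. *)

theory Defs
  imports "HOL-Analysis.Analysis"
begin

definition circumcenter :: "'a::euclidean_space \<Rightarrow> 'a \<Rightarrow> 'a \<Rightarrow> 'a" where
  "circumcenter a b c =
     (THE p. p \<in> affine hull {a, b, c} \<and> dist p a = dist p b \<and> dist p b = dist p c)"

definition bisector :: "'a::euclidean_space \<Rightarrow> 'a \<Rightarrow> 'a set" where
  "bisector y z = (\<lambda>w. midpoint y z + w) ` ({y - z}\<^sup>\<bottom>)"

definition gradient :: "('a::euclidean_space \<Rightarrow> real) \<Rightarrow> 'a \<Rightarrow> 'a" where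
  "gradient f x = (THE D. GDERIV f x :> D)"

text \<open>The set \<open>U\<close> need not be open, so smoothness (C1) is required on an open
  neighbourhood of \<open>U\<close>. If \<open>U\<close> is open, this is smoothness on \<open>U\<close> itself.\<close>

definition smooth_on :: "'a::euclidean_space set \<Rightarrow> ('a \<Rightarrow> real) \<Rightarrow> bool" where
  "smooth_on U f \<longleftrightarrow>
     (\<exists>W. open W \<and> U \<subseteq> W \<and> f differentiable_on W \<and> continuous_on W (gradient f))"

text \<open>\<open>s\<close> is the selection: \<open>s x\<close> stands for $x^+$ and \<open>s (s x)\<close> for $x^{++}$.
  The projection onto the (closed, convex) span is the library's nearest-point map.\<close>

definition pi_map :: "('a::euclidean_space \<Rightarrow> 'a) \<Rightarrow> 'a \<Rightarrow> 'a" where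
  "pi_map s x =
     2 *\<^sub>R (s (s x) - s x) + 2 *\<^sub>R closest_point (span {s (s x) - s x}) (s x - x) + x"

definition L_map :: "('a::euclidean_space \<Rightarrow> 'a) \<Rightarrow> 'a \<Rightarrow> 'a" where
  "L_map s x =
     (if \<not> collinear {x, 2 *\<^sub>R s x - x, pi_map s x}
      then circumcenter x (2 *\<^sub>R s x - x) (pi_map s x)
      else s x)"

definition zero_output_set ::
    "'a::euclidean_space set \<Rightarrow> ('a \<Rightarrow> 'a set) \<Rightarrow> ('a \<Rightarrow> real) \<Rightarrow> 'a set" where
  "zero_output_set U T \<omega> =
     {\<xi> \<in> U. \<forall>\<phi>::nat \<Rightarrow> 'a. \<phi> 0 = \<xi> \<and> (\<forall>j. \<phi> (Suc j) \<in> T (\<phi> j)) \<longrightarrow> (\<forall>k. \<omega> (\<phi> k) = 0)}"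

definition comparison_function :: "(real \<Rightarrow> real) \<Rightarrow> bool" where
  "comparison_function \<alpha> \<longleftrightarrow>
     continuous_on {0..} \<alpha> \<and> \<alpha> 0 = 0 \<and> mono_on {0..} \<alpha> \<and> \<not> bounded (\<alpha> ` {0..})"

definition lyapunov_function ::
    "'a::euclidean_space set \<Rightarrow> ('a \<Rightarrow> 'a set) \<Rightarrow> ('a \<Rightarrow> real) \<Rightarrow> ('a \<Rightarrow> real) \<Rightarrow> ('a \<Rightarrow> real) \<Rightarrow> bool" where
  "lyapunov_function U T \<omega>1 \<omega>2 V \<longleftrightarrow>
     continuous_on UNIV \<omega>1 \<and> (\<forall>x. 0 \<le> \<omega>1 x) \<and>
     continuous_on UNIV \<omega>2 \<and> (\<forall>x. 0 \<le> \<omega>2 x) \<and>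
     (\<forall>x\<in>U. 0 \<le> V x) \<and>
     (\<exists>\<alpha>1 \<alpha>2. comparison_function \<alpha>1 \<and> comparison_function \<alpha>2 \<and>
        (\<forall>x\<in>U. \<alpha>1 (\<omega>1 x) \<le> V x \<and> V x \<le> \<alpha>2 (\<omega>2 x))) \<and>
     (\<forall>x\<in>U. (SUP y\<in>T x. ereal (V y)) \<le> ereal (V x * exp (-1))) \<and>
     (\<forall>x\<in>U. V x = 0 \<longleftrightarrow> x \<in> zero_output_set U T \<omega>1)"

text \<open>\<open>MCS_except {} U s V \<Lambda> \<psi>\<close> is the class of operators on \<open>U\<close> belonging to MCS(V) with
  maps \<open>\<Lambda>\<close> and \<open>\<psi>\<close>. The set \<open>D\<close> lists points at which one single requirement,
  that \<open>\<psi> x\<close> lie in the affine hull of \<open>x\<close>, \<open>2 s x - x\<close>, \<open>\<Lambda> x\<close>, is not imposed.\<close>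

definition MCS_except ::
    "'a::euclidean_space set \<Rightarrow> 'a set \<Rightarrow> ('a \<Rightarrow> 'a) \<Rightarrow> ('a \<Rightarrow> real) \<Rightarrow> ('a \<Rightarrow> 'a) \<Rightarrow> ('a \<Rightarrow> 'a) \<Rightarrow> ('a \<Rightarrow> 'a) set" where
  "MCS_except D U s V \<Lambda> \<psi> =
     {\<Omega>. \<forall>x\<in>U.
        \<Omega> x = (if \<not> collinear {x, 2 *\<^sub>R s x - x, \<Lambda> x}
               then circumcenter x (2 *\<^sub>R s x - x) (\<Lambda> x)
               else s x) \<and>
        \<psi> x \<in> U \<and>
        \<psi> x \<in> bisector x (\<Lambda> x) \<and>
        (x \<notin> D \<longrightarrow> \<psi> x \<in> affine hull {x, 2 *\<^sub>R s x - x, \<Lambda> x}) \<and>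
        range (\<lambda>t. s x + t *\<^sub>R gradient V (s x)) \<subseteq> bisector x (2 *\<^sub>R s x - x) \<and>
        range (\<lambda>t. \<psi> x + t *\<^sub>R gradient V (\<psi> x)) \<subseteq> bisector (\<Lambda> x) x}"

abbreviation MCS ::
    "'a::euclidean_space set \<Rightarrow> ('a \<Rightarrow> 'a) \<Rightarrow> ('a \<Rightarrow> real) \<Rightarrow> ('a \<Rightarrow> 'a) \<Rightarrow> ('a \<Rightarrow> 'a) \<Rightarrow> ('a \<Rightarrow> 'a) set" where
  "MCS \<equiv> MCS_except {}"

text \<open>Points at which $x$, $x^+$, $x^{++}$ form a genuine triangle but $\pi_T x = x$ (right angle
  at $x^{++}$). There the affine hull of $x$, $2x^+ - x$, $\pi_T x$ is the line through $x$ and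
  $x^+$, which misses $x^{++}$, so the affine hull requirement fails for $\psi = T^2$.\<close>

definition degenerate_points :: "'a::euclidean_space set \<Rightarrow> ('a \<Rightarrow> 'a) \<Rightarrow> 'a set" where
  "degenerate_points U s = {x \<in> U. \<not> collinear {x, s x, s (s x)} \<and> pi_map s x = x}"

end

theory Submission
  imports Defs
begin

text \<open>Write \<open>u = x\<^sup>+\<^sup>+ - x\<^sup>+\<close> and let \<open>p\<close> be the projection of \<open>x\<^sup>+ - x\<close> onto \<open>\<real>u\<close>, so that
  \<open>\<pi>\<^sub>T x - x = 2(u + p)\<close> is a multiple of \<open>u\<close>. The point \<open>x\<^sup>+\<^sup>+\<close> differs from the midpoint of
  \<open>x\<close> and \<open>\<pi>\<^sub>T x\<close> by \<open>(x\<^sup>+ - x) - p\<close>, which is orthogonal to \<open>u\<close>; and \<open>\<nabla>V(x\<^sup>+\<^sup>+)\<close> is orthogonal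
  to \<open>u\<close> by the hypothesis at \<open>x\<^sup>+\<close>. Hence \<open>x\<^sup>+\<^sup>+\<close> and its gradient line lie on the bisector. If
  \<open>\<pi>\<^sub>T x \<noteq> x\<close>, then \<open>u\<close> is a multiple of \<open>\<pi>\<^sub>T x - x\<close>, or zero, which puts
  \<open>x\<^sup>+\<^sup>+ = x + (x\<^sup>+ - x) + u\<close> in the affine hull; otherwise \<open>x\<^sup>+\<^sup>+\<close> lies on the line through
  \<open>x\<close> and \<open>x\<^sup>+\<close>, because the point is not degenerate.\<close>

lemma mem_bisector_iff: "z \<in> bisector y w \<longleftrightarrow> (z - midpoint y w) \<bullet> (y - w) = 0"
proof -
  have "z \<in> bisector y w \<longleftrightarrow> z - midpoint y w \<in> {y - w}\<^sup>\<bottom>"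
    unfolding bisector_def by (metis (no_types, lifting) add.commute diff_add_cancel
        add_diff_cancel_left' image_iff)
  then show ?thesis
    by (simp add: orthogonal_comp_def orthogonal_def inner_commute)
qed

lemma bisector_commute: "bisector y z = bisector z y"
  by (auto simp: mem_bisector_iff midpoint_sym[of y z] inner_diff_right)

lemma closest_point_subspace_orthogonal:
  fixes S :: "'a::euclidean_space set"
  assumes S: "subspace S" and v: "v \<in> S"
  shows "(a - closest_point S a) \<bullet> v = 0"
proof -
  let ?p = "closest_point S a"
  have p: "?p \<in> S"
    using S by (intro closest_point_in_set closed_subspace) (use subspace_0 in auto)
  have "(a - ?p) \<bullet> (y - ?p) \<le> 0" if "y \<in> S" for y
    using S that by (intro closest_point_dot subspace_imp_convex closed_subspace)
  \<comment> \<open>The obtuse-angle inequality at \<open>?p + v\<close> and \<open>?p - v\<close>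
    bounds the product from both sides.\<close>
  from this[of "?p + v"] this[of "?p - v"] show ?thesis
    using S v p by (simp add: subspace_add subspace_diff)
qed

lemma affine_combination_mem_hull3:
  fixes x :: "'a::real_vector"
  shows "x + a *\<^sub>R (y - x) + b *\<^sub>R (z - x) \<in> affine hull {x, y, z}"
proof -
  have "x + a *\<^sub>R (y - x) + b *\<^sub>R (z - x) = (1 - a - b) *\<^sub>R x + a *\<^sub>R y + b *\<^sub>R z"
    by (simp add: algebra_simps)
  moreover have "(1 - a - b) + a + b = 1"
    by simp
  ultimately show ?thesis
    unfolding affine_hull_3 by blast
qed

context
  fixes s :: "'a::euclidean_space \<Rightarrow> 'a" and x :: 'a
begin

text \<open>Names the scalar \<open>c\<close> with \<open>p = c u\<close>, so that
  \<open>1 + c = 0\<close> detects collapse of \<open>pi_map s x\<close> onto \<open>x\<close> when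
  \<open>u\<close> is nonzero.\<close>

lemma pi_map_coefficient:
  obtains c where "pi_map s x - x = (2 * (1 + c)) *\<^sub>R (s (s x) - s x)"
    and "(s x - x - c *\<^sub>R (s (s x) - s x)) \<bullet> (s (s x) - s x) = 0"
proof -
  let ?u = "s (s x) - s x"
  have "closest_point (span {?u}) (s x - x) \<in> span {?u}"
    by (intro closest_point_in_set closed_span) (auto intro: span_zero)
  then obtain c where c: "closest_point (span {?u}) (s x - x) = c *\<^sub>R ?u"
    by (auto simp: span_singleton)
  from c have "pi_map s x - x = (2 * (1 + c)) *\<^sub>R ?u"
    by (simp only: pi_map_def) (simp add: algebra_simps)
  moreover have "(s x - x - c *\<^sub>R ?u) \<bullet> ?u = 0"
    using closest_point_subspace_orthogonal[of "span {?u}" ?u "s x - x"]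
    by (simp flip: c add: span_base)
  ultimately show thesis
    by (rule that)
qed

lemma iterate_line_in_bisector_pi_map:
  assumes "g \<bullet> (s (s x) - s x) = 0"
  shows "s (s x) + t *\<^sub>R g \<in> bisector (pi_map s x) x"
proof -
  let ?u = "s (s x) - s x"
  obtain c where pi: "pi_map s x - x = (2 * (1 + c)) *\<^sub>R ?u"
    and perp: "(s x - x - c *\<^sub>R ?u) \<bullet> ?u = 0"
    using pi_map_coefficient by blast
  have "midpoint (pi_map s x) x = x + (1/2) *\<^sub>R (pi_map s x - x)"
    by (simp add: midpoint_def algebra_simps flip: scaleR_2)
  also have "\<dots> = x + (1 + c) *\<^sub>R ?u"
    by (simp add: pi)
  finally have "s (s x) + t *\<^sub>R g - midpoint (pi_map s x) x = (s x - x - c *\<^sub>R ?u) + t *\<^sub>R g"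
    by (simp add: algebra_simps)
  then show ?thesis
    by (simp only: mem_bisector_iff pi inner_add_left inner_scaleR_left inner_scaleR_right
        perp assms mult_zero_right add_0_left)
qed

lemma iterate_mem_affine_hull:
  assumes nondeg: "collinear {x, s x, s (s x)} \<or> pi_map s x \<noteq> x"
  shows "s (s x) \<in> affine hull {x, 2 *\<^sub>R s x - x, pi_map s x}"
proof -
  let ?u = "s (s x) - s x"
  obtain c where pi: "pi_map s x - x = (2 * (1 + c)) *\<^sub>R ?u"
    and perp: "(s x - x - c *\<^sub>R ?u) \<bullet> ?u = 0"
    using pi_map_coefficient by blast
  \<comment> \<open>Reflecting \<open>x\<close> in \<open>s x\<close> doubles the displacement,
    whence the weights \<open>1/2\<close> and \<open>k/2\<close> below.\<close>
  have refl: "2 *\<^sub>R s x - x - x = 2 *\<^sub>R (s x - x)"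
    by (simp add: algebra_simps flip: scaleR_2)
  have "\<exists>a b. s (s x) = x + a *\<^sub>R (2 *\<^sub>R s x - x - x) + b *\<^sub>R (pi_map s x - x)"
  proof (cases "1 + c = 0 \<and> ?u \<noteq> 0")
    case False
    \<comment> \<open>If \<open>1 + c = 0\<close>, then \<open>?u = 0\<close> here and both sides
      vanish, whatever the quotient.\<close>
    then have "?u = (1 / (2 * (1 + c))) *\<^sub>R (pi_map s x - x)"
      by (auto simp: pi)
    then have "s (s x) = x + (1/2) *\<^sub>R (2 *\<^sub>R s x - x - x)
        + (1 / (2 * (1 + c))) *\<^sub>R (pi_map s x - x)"
      by (simp add: refl diff_eq_eq add.commute)
    then show ?thesis by blast
  next
    case True
    then have c: "c = -1" and "pi_map s x = x"
      using pi by auto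
    then have col: "collinear {x, s x, s (s x)}"
      using nondeg by simp
    \<comment> \<open>A fixed point would give \<open>s (s x) = s x\<close>, that is
      \<open>?u = 0\<close>. So \<open>s x - x\<close> spans the line containing
      \<open>s (s x) - x\<close>.\<close>
    have "s x \<noteq> x"
      using perp True c by auto
    moreover have "collinear {0, s x - x, s (s x) - x}"
      using col by (simp add: collinear_3[of "s x" x "s (s x)", symmetric] insert_commute)
    ultimately obtain k where "s (s x) - x = k *\<^sub>R (s x - x)"
      by (metis collinear_lemma eq_iff_diff_eq_0 scaleR_zero_left)
    then have "s (s x) = x + (k/2) *\<^sub>R (2 *\<^sub>R s x - x - x) + 0 *\<^sub>R (pi_map s x - x)"
      by (simp add: refl diff_eq_eq add.commute)
    then show ?thesis by blast
  qed
  then show ?thesis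
    using affine_combination_mem_hull3 by metis
qed

end

theorem theorem4:
  fixes U :: "'a::euclidean_space set"
    and T :: "'a \<Rightarrow> 'a set"
    and s :: "'a \<Rightarrow> 'a"
    and V \<omega>1 \<omega>2 :: "'a \<Rightarrow> real"
  assumes T_into: "\<And>x. x \<in> U \<Longrightarrow> T x \<subseteq> U"
    and selection: "\<And>x. x \<in> U \<Longrightarrow> s x \<in> T x"
    and lyapunov: "lyapunov_function U T \<omega>1 \<omega>2 V"
    and smooth: "smooth_on U V"
    and orth: "\<And>x. x \<in> U \<Longrightarrow> gradient V (s x) \<bullet> (x - s x) = 0"
  shows "L_map s \<in> MCS_except (degenerate_points U s) U s V (pi_map s) (\<lambda>x. s (s x))
       \<and> (degenerate_points U s = {} \<longrightarrow> L_map s \<in> MCS U s V (pi_map s) (\<lambda>x. s (s x)))"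
proof -
  have sU: "s x \<in> U" if "x \<in> U" for x
    using T_into selection that by blast
  have reflected: "s x + t *\<^sub>R gradient V (s x) \<in> bisector x (2 *\<^sub>R s x - x)" if "x \<in> U" for x t
  proof -
    have "x - (2 *\<^sub>R s x - x) = 2 *\<^sub>R (x - s x)"
      by (simp add: algebra_simps flip: scaleR_2)
    then show ?thesis
      using orth[OF that] by (simp add: mem_bisector_iff midpoint_def)
  qed
  have iterate: "s (s x) + t *\<^sub>R gradient V (s (s x)) \<in> bisector (pi_map s x) x"
    if "x \<in> U" for x t
    using orth[OF sU[OF that]]
    by (intro iterate_line_in_bisector_pi_map) (simp add: inner_diff_right)
  \<comment> \<open>The iterate itself is the point \<open>t = 0\<close> of its gradient
    line.\<close>
  have "s (s x) \<in> bisector x (pi_map s x)" if "x \<in> U" for x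
    using iterate[OF that, of 0] by (simp add: bisector_commute)
  moreover have "s (s x) \<in> affine hull {x, 2 *\<^sub>R s x - x, pi_map s x}"
    if "x \<in> U" "x \<notin> degenerate_points U s" for x
    using that by (intro iterate_mem_affine_hull) (auto simp: degenerate_points_def)
  ultimately have "L_map s \<in> MCS_except (degenerate_points U s) U s V (pi_map s) (\<lambda>x. s (s x))"
    unfolding MCS_except_def L_map_def using sU reflected iterate by (simp add: image_subset_iff)
  then show ?thesis
    by auto
qed

end
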